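(* Let $k$ be a positive odd integer, $R$ an $n$-tournament, and $R(a_1,\dots,a_n)$ a transitive blowup of $R$ (with $a_1,\dots,a_n$ positive integers). Then $R\in\mathcal{D}_k$ if and only if $R(a_1,\dots,a_n)\in\mathcal{D}_k$.
   Context: A tournament is a directed graph with exactly one arc between each pair of distinct vertices; $u\rightarrow v$ means the arc goes from $u$ to $v$. For a tournament $T$ on vertices $v_1,\dots,v_n$, its skew-adjacency matrix is the zero-diagonal matrix $S_T=[s_{ij}]$ with $s_{ij}=-s_{ji}=1$ if $v_i\rightarrow v_j$, and $\det(T):=\det(S_T)$. A subtournament is the tournament induced by a nonempty vertex subset (including $T$ itself). $\mathcal{D}_k$ is the set of tournaments all of whose subtournaments have determinant at most $k^2$. A tournament is transitive if it has no directed 3-cycle. For an $n$-tournament $R$ with vertices $v_1,\dots,v_n$ and positive integers $a_1,\dots,a_n$, the transitive blowup $R(a_1,\dots,a_n)$ replaces each $v_i$ by a transitive tournament on $a_i$ vertices, with all arcs from the $i$-th block to the $j$-th block whenever $v_i\rightarrow v_j$ in $R$. *)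

theory Defs
  imports "Graph_Theory.Digraph_Component" "Jordan_Normal_Form.Determinant"
begin

definition tournament :: "'a pair_pre_digraph \<Rightarrow> bool" where
  "tournament T \<longleftrightarrow> pair_digraph T \<and>
     (\<forall>u \<in> pverts T. \<forall>v \<in> pverts T. u \<noteq> v \<longrightarrow> ((u, v) \<in> parcs T) \<noteq> ((v, u) \<in> parcs T))"

definition subtournament :: "'a pair_pre_digraph \<Rightarrow> 'a pair_pre_digraph \<Rightarrow> bool" where
  "subtournament H T \<longleftrightarrow> induced_subgraph (with_proj H) (with_proj T) \<and> pverts H \<noteq> {}"

text \<open>The list \<open>vs\<close> is the ordering of the vertices that indexes the rows and columns.\<close>

definition skew_adj_mat :: "'a pair_pre_digraph \<Rightarrow> 'a list \<Rightarrow> int mat" where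
  "skew_adj_mat T vs = mat (length vs) (length vs)
     (\<lambda>(i, j). if (vs ! i, vs ! j) \<in> parcs T then 1
               else if (vs ! j, vs ! i) \<in> parcs T then - 1 else 0)"

text \<open>The choice of the vertex ordering is immaterial, see \<open>tdet_eq\<close> below.\<close>

definition tdet :: "'a pair_pre_digraph \<Rightarrow> int" where
  "tdet T = det (skew_adj_mat T (SOME vs. distinct vs \<and> set vs = pverts T))"

definition det_class :: "nat \<Rightarrow> 'a pair_pre_digraph set" where
  "det_class k = {T. tournament T \<and> (\<forall>H. subtournament H T \<longrightarrow> tdet H \<le> (int k)\<^sup>2)}"

definition transitive_tournament :: "'a pair_pre_digraph \<Rightarrow> bool" where
  "transitive_tournament T \<longleftrightarrow> tournament T \<and>
     \<not> (\<exists>u v w. (u, v) \<in> parcs T \<and> (v, w) \<in> parcs T \<and> (w, u) \<in> parcs T)"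

text \<open>
  \<open>transitive_blowup R a T\<close>: the tournament \<open>T\<close> is (a copy of) the blowup of \<open>R\<close> with
  multiplicities \<open>a\<close>, indexed by the vertices of \<open>R\<close>. The transitive tournament
  replacing \<open>v\<close> is \<open>B v\<close>; the blocks are disjoint but their vertices are otherwise arbitrary.
\<close>

definition transitive_blowup ::
  "'a pair_pre_digraph \<Rightarrow> ('a \<Rightarrow> nat) \<Rightarrow> 'b pair_pre_digraph \<Rightarrow> bool" where
  "transitive_blowup R a T \<longleftrightarrow> (\<exists>B :: 'a \<Rightarrow> 'b pair_pre_digraph.
     (\<forall>v \<in> pverts R. transitive_tournament (B v) \<and> card (pverts (B v)) = a v) \<and>
     (\<forall>u \<in> pverts R. \<forall>v \<in> pverts R. u \<noteq> v \<longrightarrow> pverts (B u) \<inter> pverts (B v) = {}) \<and>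
     pverts T = (\<Union>v \<in> pverts R. pverts (B v)) \<and>
     parcs T = (\<Union>v \<in> pverts R. parcs (B v)) \<union>
               (\<Union>(u, v) \<in> parcs R. pverts (B u) \<times> pverts (B v)))"

lemma det_permute_rows_cols:
  fixes A :: "'c :: comm_ring_1 mat"
  assumes A: "A \<in> carrier_mat n n" and p: "p permutes {0..<n}"
  shows "det (mat n n (\<lambda>(i, j). A $$ (p i, p j))) = det A"
proof -
  have pn: "p i < n" if "i < n" for i
    using permutes_in_image[OF p, of i] that by simp
  let ?B = "mat n n (\<lambda>(i, j). A $$ (i, p j))"
  let ?C = "mat n n (\<lambda>(i, j). A\<^sup>T $$ (p i, j))"
  have "mat n n (\<lambda>(i, j). A $$ (p i, p j)) = mat n n (\<lambda>(i, j). ?B $$ (p i, j))"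
    by (rule eq_matI) (auto simp: pn)
  then have "det (mat n n (\<lambda>(i, j). A $$ (p i, p j))) = signof p * det ?B"
    using det_permute_rows[OF _ p, of ?B] by simp
  also have "?B = ?C\<^sup>T"
    using A by (intro eq_matI) (auto simp: pn)
  also have "det (?C\<^sup>T) = det ?C"
    by (rule det_transpose[of _ n]) simp
  also have "\<dots> = signof p * det (A\<^sup>T)"
    using A by (intro det_permute_rows[OF _ p]) simp
  also have "det (A\<^sup>T) = det A"
    by (rule det_transpose[OF A])
  also have "signof p * (signof p * det A) = det A"
    by (simp add: sign_def)
  finally show ?thesis .
qed

lemma det_skew_adj_mat_cong:
  assumes "distinct vs" "distinct ws" "set vs = set ws"
  shows "det (skew_adj_mat T vs) = det (skew_adj_mat T ws)"
proof -
  have "mset vs = mset ws"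
    using assms by (simp add: set_eq_iff_mset_eq_distinct)
  then obtain p where p: "p permutes {..<length ws}" "permute_list p ws = vs"
    by (rule mset_eq_permutation)
  let ?n = "length ws"
  have p': "p permutes {0..<?n}" using p(1) by (simp add: atLeast0LessThan)
  have pn: "p i < ?n" if "i < ?n" for i
    using permutes_in_image[OF p', of i] that by simp
  have len: "length vs = ?n" using p(2) by auto
  have nth: "vs ! i = ws ! p i" if "i < ?n" for i
    using permute_list_nth[OF p(1) that] p(2) by simp
  have "skew_adj_mat T vs = mat ?n ?n (\<lambda>(i, j). skew_adj_mat T ws $$ (p i, p j))"
    by (rule eq_matI) (auto simp: skew_adj_mat_def len nth pn)
  moreover have "skew_adj_mat T ws \<in> carrier_mat ?n ?n"
    by (simp add: skew_adj_mat_def)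
  ultimately show ?thesis
    using det_permute_rows_cols[OF _ p'] by simp
qed

lemma tdet_eq:
  assumes "distinct vs" "set vs = pverts T"
  shows "tdet T = det (skew_adj_mat T vs)"
proof -
  have "distinct (SOME vs. distinct vs \<and> set vs = pverts T) \<and>
        set (SOME vs. distinct vs \<and> set vs = pverts T) = pverts T"
    by (rule someI[of _ vs]) (use assms in simp)
  then show ?thesis
    unfolding tdet_def using assms by (intro det_skew_adj_mat_cong) auto
qed

lemma transitive_blowup_exists:
  fixes R :: "'a pair_pre_digraph" and a :: "'a \<Rightarrow> nat"
  shows "\<exists>T :: ('a \<times> nat) pair_pre_digraph. transitive_blowup R a T"
proof -
  define B :: "'a \<Rightarrow> ('a \<times> nat) pair_pre_digraph" where
    "B v = \<lparr>pverts = {v} \<times> {..<a v},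
            parcs = {((v, i), (v, j)) | i j. i < j \<and> j < a v}\<rparr>" for v
  have verts: "pverts (B v) = {v} \<times> {..<a v}" for v
    by (simp add: B_def)
  have arcs: "(x, y) \<in> parcs (B v) \<longleftrightarrow> fst x = v \<and> fst y = v \<and> snd x < snd y \<and> snd y < a v"
    for x y v by (cases x; cases y) (auto simp: B_def)
  have "parcs (B v) \<subseteq> pverts (B v) \<times> pverts (B v)" for v
    by (auto simp: B_def)
  then have "finite (parcs (B v))" for v
    by (rule finite_subset) (simp add: verts)
  then have "pair_digraph (B v)" for v
    by unfold_locales (auto simp: verts arcs)
  then have "tournament (B v)" for v
    unfolding tournament_def by (auto simp: verts arcs)
  moreover have "\<not> (\<exists>x y z. (x, y) \<in> parcs (B v) \<and> (y, z) \<in> parcs (B v) \<and> (z, x) \<in> parcs (B v))" for v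
    by (auto simp: arcs)
  ultimately have "transitive_tournament (B v)" for v
    by (auto simp only: transitive_tournament_def)
  moreover have "card (pverts (B v)) = a v" for v
    by (simp add: verts)
  moreover have "pverts (B u) \<inter> pverts (B v) = {}" if "u \<noteq> v" for u v
    using that by (auto simp: verts)
  ultimately have "transitive_blowup R a
      \<lparr>pverts = (\<Union>v \<in> pverts R. pverts (B v)),
       parcs = (\<Union>v \<in> pverts R. parcs (B v)) \<union>
               (\<Union>(u, v) \<in> parcs R. pverts (B u) \<times> pverts (B v))\<rparr>"
    unfolding transitive_blowup_def by (intro exI[of _ B]) simp
  then show ?thesis by blast
qed

end

theory Submission
  imports Defs
begin

text \<open>
  Two vertices of a block that are consecutive in the transitive order have the same arcs to every
  other vertex. Subtracting one of them from the other, in rows and in columns, and expanding the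
  determinant shows that removing both does not change the determinant. So every subtournament of
  the blowup has the determinant of one that meets each block at most once, which is either empty,
  with determinant \<open>1 \<le> k\<^sup>2\<close>, or a copy of a subtournament of \<open>R\<close>. Conversely
  choosing one vertex in each block embeds \<open>R\<close> in its blowup.
\<close>

section \<open>Determinants and pairs of twin vertices\<close>

text \<open>Two Laplace expansions, along row 0 and then along the first column of the remaining
  minor. The first contributes the cofactor sign -1, the second the entry -1, and the two signs
  cancel.\<close>

lemma det_eq_det_remove_two:
  fixes A :: "'c :: comm_ring_1 mat"
  assumes A: "A \<in> carrier_mat (Suc (Suc n)) (Suc (Suc n))"
    and row: "\<And>j. j < Suc (Suc n) \<Longrightarrow> A $$ (0, j) = (if j = 1 then 1 else 0)"
    and col: "\<And>i. i < Suc (Suc n) \<Longrightarrow> A $$ (i, 0) = (if i = 1 then - 1 else 0)"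
  shows "det A = det (mat n n (\<lambda>(i, j). A $$ (Suc (Suc i), Suc (Suc j))))"
proof -
  let ?M = "mat_delete A 0 1"
  have M: "?M \<in> carrier_mat (Suc n) (Suc n)"
    using mat_delete_carrier[OF A] by simp
  \<comment> \<open>Deleting row 0 shifts the rows up by one, so the entry -1 of column 0 moves from
    row 1 to row 0.\<close>
  have Mcol: "?M $$ (i, 0) = (if i = 0 then - 1 else 0)" if "i < Suc n" for i
    using that A col[of "Suc i"] by (auto simp: mat_delete_def)
  have "det A = (\<Sum>j<Suc (Suc n). A $$ (0, j) * cofactor A 0 j)"
    by (rule laplace_expansion_row[OF A]) simp
  also have "\<dots> = (\<Sum>j<Suc (Suc n). if j = 1 then cofactor A 0 1 else 0)"
    by (rule sum.cong) (auto simp: row)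
  also have "\<dots> = - det ?M"
    by (simp add: cofactor_def)
  also have "det ?M = (\<Sum>i<Suc n. ?M $$ (i, 0) * cofactor ?M i 0)"
    by (rule laplace_expansion_column[OF M]) simp
  also have "\<dots> = (\<Sum>i<Suc n. if i = 0 then - cofactor ?M 0 0 else 0)"
    by (rule sum.cong) (simp_all add: Mcol del: One_nat_def)
  also have "\<dots> = - det (mat_delete ?M 0 0)"
    by (simp add: cofactor_def)
  also have "mat_delete ?M 0 0 = mat n n (\<lambda>(i, j). A $$ (Suc (Suc i), Suc (Suc j)))"
    using A by (intro eq_matI) (auto simp: mat_delete_def)
  finally show ?thesis by simp
qed

text \<open>The rows of \<open>u\<close> and \<open>w\<close> agree outside their own two columns,
  and likewise the columns, so subtracting row and column 1 from row and column 0 leaves only the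
  entries 1 and -1 that come from the arc between \<open>u\<close> and \<open>w\<close>. As
  \<open>T\<close> is an arbitrary digraph here, outgoing and incoming arcs get separate
  hypotheses.\<close>

lemma det_skew_adj_mat_remove_twins:
  assumes uw: "(u, w) \<in> parcs T" "(w, u) \<notin> parcs T" "(u, u) \<notin> parcs T" "(w, w) \<notin> parcs T"
    and twins: "\<And>x. x \<in> set vs \<Longrightarrow> (u, x) \<in> parcs T \<longleftrightarrow> (w, x) \<in> parcs T"
      "\<And>x. x \<in> set vs \<Longrightarrow> (x, u) \<in> parcs T \<longleftrightarrow> (x, w) \<in> parcs T"
  shows "det (skew_adj_mat T (u # w # vs)) = det (skew_adj_mat T vs)"
proof -
  let ?n = "length vs" and ?N = "Suc (Suc (length vs))"
  let ?S = "skew_adj_mat T (u # w # vs)"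
  define A where "A = addcol (- 1) 0 1 (addrow (- 1) 0 1 ?S)"
  have S: "?S \<in> carrier_mat ?N ?N"
    by (simp add: skew_adj_mat_def)
  have twins_nth: "(u, vs ! i) \<in> parcs T \<longleftrightarrow> (w, vs ! i) \<in> parcs T"
    "(vs ! i, u) \<in> parcs T \<longleftrightarrow> (vs ! i, w) \<in> parcs T" if "i < ?n" for i
    using twins nth_mem[OF that] by blast+
  have A: "A \<in> carrier_mat ?N ?N"
    using S by (auto simp: A_def mat_addcol_def mat_addrow_def)
  have "det A = det ?S"
    using S by (simp add: A_def det_addcol[where n = ?N] det_addrow[where n = ?N])
  moreover have "det A = det (mat ?n ?n (\<lambda>(i, j). A $$ (Suc (Suc i), Suc (Suc j))))"
  proof (rule det_eq_det_remove_two[OF A])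
    \<comment> \<open>After the row operation, row 0 starts with 1, 1; the column operation turns
      the first 1 into 0. From index 2 on, column \<open>j\<close> belongs to
      \<open>vs ! (j - 2)\<close>, where the twins cancel.\<close>
    show "A $$ (0, j) = (if j = 1 then 1 else 0)" if "j < ?N" for j
      using that uw twins_nth[of "j - 2"]
      by (auto simp: A_def skew_adj_mat_def mat_addrow_def mat_addcol_def nth_Cons numeral_2_eq_2
          split: nat.splits)
    show "A $$ (i, 0) = (if i = 1 then - 1 else 0)" if "i < ?N" for i
      using that uw twins_nth[of "i - 2"]
      by (auto simp: A_def skew_adj_mat_def mat_addrow_def mat_addcol_def nth_Cons numeral_2_eq_2
          split: nat.splits)
  qed
  moreover have "mat ?n ?n (\<lambda>(i, j). A $$ (Suc (Suc i), Suc (Suc j))) = skew_adj_mat T vs"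
    by (rule eq_matI) (auto simp: A_def skew_adj_mat_def)
  ultimately show ?thesis by simp
qed

section \<open>Subtournaments and determinant classes through lists of vertices\<close>

lemma tournamentD:
  assumes "tournament T"
  shows "finite (pverts T)" "(x, y) \<in> parcs T \<Longrightarrow> x \<in> pverts T \<and> y \<in> pverts T \<and> x \<noteq> y"
    "x \<in> pverts T \<Longrightarrow> y \<in> pverts T \<Longrightarrow> x \<noteq> y \<Longrightarrow> (x, y) \<in> parcs T \<longleftrightarrow> (y, x) \<notin> parcs T"
proof -
  interpret pair_digraph T using assms by (simp add: tournament_def)
  show "finite (pverts T)" by simp
  show "x \<in> pverts T \<and> y \<in> pverts T \<and> x \<noteq> y" if "(x, y) \<in> parcs T"
    using that in_arcsD1 in_arcsD2 no_loops' by blast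
  show "(x, y) \<in> parcs T \<longleftrightarrow> (y, x) \<notin> parcs T"
    if "x \<in> pverts T" "y \<in> pverts T" "x \<noteq> y"
    using assms that unfolding tournament_def by metis
qed

lemma subtournament_iff:
  assumes "tournament T"
  shows "subtournament H T \<longleftrightarrow>
    pverts H \<noteq> {} \<and> pverts H \<subseteq> pverts T \<and> parcs H = parcs T \<inter> pverts H \<times> pverts H"
proof -
  interpret pair_digraph T using assms by (simp add: tournament_def)
  have wf: "wf_digraph (with_proj T)" by unfold_locales
  show ?thesis
  proof
    assume "subtournament H T"
    then show "pverts H \<noteq> {} \<and> pverts H \<subseteq> pverts T \<and> parcs H = parcs T \<inter> pverts H \<times> pverts H"
      unfolding subtournament_def induced_subgraph_def subgraph_def by fastforce
  next
    assume H: "pverts H \<noteq> {} \<and> pverts H \<subseteq> pverts T \<and> parcs H = parcs T \<inter> pverts H \<times> pverts H"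
    then have "wf_digraph (with_proj H)"
      by unfold_locales auto
    with wf H show "subtournament H T"
      unfolding subtournament_def induced_subgraph_def subgraph_def compatible_def by auto
  qed
qed

lemma mem_det_class_iff:
  assumes T: "tournament T" and k: "0 < k"
  shows "T \<in> det_class k \<longleftrightarrow>
    (\<forall>vs. distinct vs \<and> set vs \<subseteq> pverts T \<longrightarrow> det (skew_adj_mat T vs) \<le> (int k)\<^sup>2)"
    (is "_ \<longleftrightarrow> ?bounded")
proof -
  have tdet_H: "tdet H = det (skew_adj_mat T vs)"
    if "subtournament H T" "distinct vs" "set vs = pverts H" for H vs
  proof -
    have "parcs H = parcs T \<inter> set vs \<times> set vs"
      using that by (simp add: subtournament_iff[OF T])
    then have "skew_adj_mat H vs = skew_adj_mat T vs"
      by (intro eq_matI) (simp_all add: skew_adj_mat_def)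
    with tdet_eq[OF that(2,3)] show ?thesis by simp
  qed
  show ?thesis
  proof
    assume L: "T \<in> det_class k"
    show ?bounded
    proof (intro allI impI)
      fix vs assume vs: "distinct vs \<and> set vs \<subseteq> pverts T"
      show "det (skew_adj_mat T vs) \<le> (int k)\<^sup>2"
      proof (cases "vs = []")
        \<comment> \<open>The empty matrix has determinant 1, which is at most the square of
          \<open>k\<close> since \<open>k\<close> is positive.\<close>
        case True
        then show ?thesis using k by (simp add: skew_adj_mat_def)
      next
        case False
        let ?H = "\<lparr>pverts = set vs, parcs = parcs T \<inter> set vs \<times> set vs\<rparr>"
        have "subtournament ?H T"
          using vs False by (simp add: subtournament_iff[OF T])
        with tdet_H[OF this, of vs] vs L show ?thesis
          by (auto simp: det_class_def)
      qed
    qed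
  next
    assume R: ?bounded
    have "finite (pverts T)"
      using tournamentD(1)[OF T] .
    then have "tdet H \<le> (int k)\<^sup>2" if H: "subtournament H T" for H
      using tdet_H[OF H] R H
      by (metis finite_distinct_list finite_subset subtournament_iff[OF T])
    with T show "T \<in> det_class k" by (simp add: det_class_def)
  qed
qed

section \<open>Blowups seen through the projection onto the blocks\<close>

text \<open>The blocks are the fibres of \<open>b\<close>. This keeps from a blowup only what the
  determinant argument needs: no fibre over a vertex of \<open>R\<close> is empty, arcs between
  fibres come from \<open>R\<close>, and fibres contain no directed triangle.\<close>

definition block_map :: "'a pair_pre_digraph \<Rightarrow> 'b pair_pre_digraph \<Rightarrow> ('b \<Rightarrow> 'a) \<Rightarrow> bool" where
  "block_map R T b \<longleftrightarrow> b ` pverts T = pverts R \<and>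
     (\<forall>x \<in> pverts T. \<forall>y \<in> pverts T. b x \<noteq> b y \<longrightarrow>
        ((x, y) \<in> parcs T \<longleftrightarrow> (b x, b y) \<in> parcs R)) \<and>
     (\<forall>x \<in> pverts T. \<forall>y \<in> pverts T. \<forall>z \<in> pverts T. b x = b y \<and> b y = b z \<longrightarrow>
        \<not> ((x, y) \<in> parcs T \<and> (y, z) \<in> parcs T \<and> (z, x) \<in> parcs T))"

text \<open>Disjointness of the blocks makes the projection well defined, and positivity of the
  multiplicities makes it onto.\<close>

lemma transitive_blowup_block_map:
  assumes R: "tournament R" and a: "\<forall>v \<in> pverts R. 0 < a v" and T: "transitive_blowup R a T"
  obtains b where "tournament T" "block_map R T b"
proof -
  obtain B where B: "\<And>v. v \<in> pverts R \<Longrightarrow> transitive_tournament (B v)"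
    and card: "\<And>v. v \<in> pverts R \<Longrightarrow> card (pverts (B v)) = a v"
    and disj: "\<And>u v. u \<in> pverts R \<Longrightarrow> v \<in> pverts R \<Longrightarrow> u \<noteq> v \<Longrightarrow> pverts (B u) \<inter> pverts (B v) = {}"
    and verts: "pverts T = (\<Union>v \<in> pverts R. pverts (B v))"
    and arcs: "parcs T = (\<Union>v \<in> pverts R. parcs (B v)) \<union>
               (\<Union>(u, v) \<in> parcs R. pverts (B u) \<times> pverts (B v))"
    using T unfolding transitive_blowup_def by (elim exE conjE) metis
  have tB: "tournament (B v)" if "v \<in> pverts R" for v
    using B[OF that] by (simp add: transitive_tournament_def)
  note RD = tournamentD[OF R] and BD = tournamentD[OF tB]
  define b where "b x = (THE v. v \<in> pverts R \<and> x \<in> pverts (B v))" for x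
  have b_eq: "b x = v" if "v \<in> pverts R" "x \<in> pverts (B v)" for x v
    unfolding b_def using that disj by (intro the_equality) blast+
  have b_verts: "b x \<in> pverts R \<and> x \<in> pverts (B (b x))" if "x \<in> pverts T" for x
    using that b_eq by (auto simp: verts)
  \<comment> \<open>The two sources of arcs of \<open>T\<close> do not interfere: arcs of a block
    stay within it, and since \<open>R\<close> has no loops, product arcs always join different
    blocks.\<close>
  have arc_iff: "(x, y) \<in> parcs T \<longleftrightarrow>
      (if b x = b y then (x, y) \<in> parcs (B (b x)) else (b x, b y) \<in> parcs R)"
    if "x \<in> pverts T" "y \<in> pverts T" for x y
  proof -
    have "(\<exists>v \<in> pverts R. (x, y) \<in> parcs (B v)) \<longleftrightarrow> b x = b y \<and> (x, y) \<in> parcs (B (b x))"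
      using b_verts[OF that(1)] b_eq BD(2) by metis
    moreover have "(\<exists>(u, v) \<in> parcs R. x \<in> pverts (B u) \<and> y \<in> pverts (B v)) \<longleftrightarrow> (b x, b y) \<in> parcs R"
    proof
      assume "\<exists>(u, v) \<in> parcs R. x \<in> pverts (B u) \<and> y \<in> pverts (B v)"
      then obtain u v where uv: "(u, v) \<in> parcs R" "x \<in> pverts (B u)" "y \<in> pverts (B v)"
        by blast
      with RD(2)[OF uv(1)] b_eq show "(b x, b y) \<in> parcs R" by metis
    next
      assume "(b x, b y) \<in> parcs R"
      with b_verts[OF that(1)] b_verts[OF that(2)]
      show "\<exists>(u, v) \<in> parcs R. x \<in> pverts (B u) \<and> y \<in> pverts (B v)" by blast
    qed
    ultimately show ?thesis
      using RD(2)[of "b x" "b y"] by (auto simp: arcs)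
  qed
  have arc_verts: "x \<in> pverts T \<and> y \<in> pverts T" if "(x, y) \<in> parcs T" for x y
    using that RD(2) BD(2) by (fastforce simp: arcs verts)
  have fin: "finite (pverts T)"
    using RD(1) BD(1) by (simp add: verts)
  have "parcs T \<subseteq> pverts T \<times> pverts T"
    using arc_verts by auto
  then have finA: "finite (parcs T)"
    using fin finite_subset by blast
  have noloop: "(x, x) \<notin> parcs T" for x
    using arc_iff[of x x] arc_verts[of x x] b_verts[of x] BD(2)[of "b x" x x] by auto
  have "pair_digraph T"
    using fin finA arc_verts noloop by unfold_locales auto
  moreover have "(x, y) \<in> parcs T \<longleftrightarrow> (y, x) \<notin> parcs T"
    if "x \<in> pverts T" "y \<in> pverts T" "x \<noteq> y" for x y
    using that b_verts[OF that(1)] b_verts[OF that(2)] RD(3)[of "b x" "b y"] BD(3)[of "b x" x y]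
    unfolding arc_iff[OF that(1,2)] arc_iff[OF that(2,1)] by (cases "b x = b y") simp_all
  ultimately have "tournament T" unfolding tournament_def by metis
  moreover have "b ` pverts T = pverts R"
  proof
    show "b ` pverts T \<subseteq> pverts R" using b_verts by auto
    show "pverts R \<subseteq> b ` pverts T"
    proof
      fix v assume v: "v \<in> pverts R"
      then have "pverts (B v) \<noteq> {}" using a card[OF v] by auto
      then obtain x where "x \<in> pverts (B v)" by auto
      then show "v \<in> b ` pverts T" using v b_eq by (auto simp: verts)
    qed
  qed
  moreover have "\<not> ((x, y) \<in> parcs T \<and> (y, z) \<in> parcs T \<and> (z, x) \<in> parcs T)"
    if "x \<in> pverts T" "y \<in> pverts T" "z \<in> pverts T" "b x = b y" "b y = b z" for x y z
  proof -
    have "\<not> ((x, y) \<in> parcs (B (b z)) \<and> (y, z) \<in> parcs (B (b z)) \<and> (z, x) \<in> parcs (B (b z)))"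
      using B b_verts[OF that(3)] unfolding transitive_tournament_def by blast
    with that show ?thesis by (simp add: arc_iff)
  qed
  moreover have "(x, y) \<in> parcs T \<longleftrightarrow> (b x, b y) \<in> parcs R"
    if "x \<in> pverts T" "y \<in> pverts T" "b x \<noteq> b y" for x y
    using that by (simp add: arc_iff)
  ultimately show ?thesis
    using that[of b] unfolding block_map_def by blast
qed

section \<open>Comparing determinants in \<open>R\<close> and in the blowup\<close>

text \<open>With at most one vertex per block, \<open>b\<close> is an isomorphism onto its image, so
  the two matrices coincide. Both directions of the theorem use this.\<close>

lemma det_skew_adj_mat_map:
  assumes R: "tournament R" and T: "tournament T" and b: "block_map R T b"
    and vs: "set vs \<subseteq> pverts T" "inj_on b (set vs)"
  shows "det (skew_adj_mat R (map b vs)) = det (skew_adj_mat T vs)"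
proof -
  have "(b x, b y) \<in> parcs R \<longleftrightarrow> (x, y) \<in> parcs T" if "x \<in> set vs" "y \<in> set vs" for x y
  proof (cases "x = y")
    case True
    then show ?thesis using tournamentD(2)[OF R] tournamentD(2)[OF T] by blast
  next
    case False
    then have "b x \<noteq> b y" using vs(2) that by (auto simp: inj_on_def)
    then show ?thesis using b that vs(1) unfolding block_map_def by (metis subsetD)
  qed
  then have "skew_adj_mat R (map b vs) = skew_adj_mat T vs"
    by (intro eq_matI) (auto simp: skew_adj_mat_def)
  then show ?thesis by simp
qed

text \<open>Induction on \<open>S\<close>: if the source \<open>u\<close> of \<open>F\<close> does
  not beat the new vertex \<open>y\<close>, then \<open>y\<close> beats \<open>u\<close>, and an arc
  from some \<open>x\<close> in \<open>F\<close> to \<open>y\<close> would close the directed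
  triangle \<open>y\<close>, \<open>u\<close>, \<open>x\<close> inside one block. Hence
  \<open>y\<close> is the new source.\<close>

lemma block_source:
  assumes T: "tournament T" and b: "block_map R T b"
    and S: "finite S" "S \<noteq> {}" "S \<subseteq> pverts T" "\<And>x. x \<in> S \<Longrightarrow> b x = v"
  obtains u where "u \<in> S" "\<And>x. x \<in> S \<Longrightarrow> x \<noteq> u \<Longrightarrow> (u, x) \<in> parcs T"
proof -
  have "\<exists>u \<in> S. \<forall>x \<in> S. x \<noteq> u \<longrightarrow> (u, x) \<in> parcs T"
    using S
  proof (induction S rule: finite_ne_induct)
    case (singleton x)
    then show ?case by simp
  next
    case (insert y F)
    then obtain u where u: "u \<in> F" "\<forall>x \<in> F. x \<noteq> u \<longrightarrow> (u, x) \<in> parcs T" by auto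
    show ?case
    proof (cases "(u, y) \<in> parcs T")
      case True
      with u show ?thesis by auto
    next
      case False
      then have yu: "(y, u) \<in> parcs T"
        using tournamentD(3)[OF T, of y u] u insert by auto
      have "(y, x) \<in> parcs T" if x: "x \<in> F" for x
      proof (cases "x = u")
        case True
        with yu show ?thesis by simp
      next
        case False
        have "x \<noteq> y" using x insert by auto
        have "b x = v" "b y = v" "b u = v" "x \<in> pverts T" "y \<in> pverts T" "u \<in> pverts T"
          using insert.prems x u(1) by auto
        moreover have "(u, x) \<in> parcs T" using u x False by auto
        ultimately have "(x, y) \<notin> parcs T"
          using b yu unfolding block_map_def by metis
        then show ?thesis
          using tournamentD(3)[OF T, of y x] \<open>x \<noteq> y\<close> \<open>x \<in> pverts T\<close> \<open>y \<in> pverts T\<close> by auto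
      qed
      then show ?thesis by auto
    qed
  qed
  then show ?thesis using that by blast
qed

text \<open>As long as some block is met twice, a pair of twins can be removed, which shortens the
  list; hence strong induction on its length.\<close>

lemma det_skew_adj_mat_reduce:
  assumes T: "tournament T" and b: "block_map R T b"
    and vs: "distinct vs" "set vs \<subseteq> pverts T"
  shows "\<exists>ws. distinct ws \<and> set ws \<subseteq> pverts T \<and> inj_on b (set ws) \<and>
    det (skew_adj_mat T vs) = det (skew_adj_mat T ws)"
  using vs
proof (induction "length vs" arbitrary: vs rule: less_induct)
  case less
  note TD = tournamentD[OF T]
  show ?case
  proof (cases "inj_on b (set vs)")
    case True
    with less.prems show ?thesis by blast
  next
    case False
    then obtain p q where pq: "p \<in> set vs" "q \<in> set vs" "p \<noteq> q" "b p = b q"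
      by (auto simp: inj_on_def)
    \<comment> \<open>Only the part of the block that occurs in \<open>vs\<close> matters: twins
      need to agree on the listed vertices alone.\<close>
    define S where "S = {x \<in> set vs. b x = b q}"
    have S: "finite S" "S \<subseteq> pverts T" "\<And>x. x \<in> S \<Longrightarrow> b x = b q" "p \<in> S" "q \<in> S"
      using less.prems pq by (auto simp: S_def)
    obtain u where u: "u \<in> S" "\<And>x. x \<in> S \<Longrightarrow> x \<noteq> u \<Longrightarrow> (u, x) \<in> parcs T"
      using block_source[OF T b, of S "b q"] S by blast
    \<comment> \<open>The source of what remains is the second vertex in the transitive order on
      \<open>S\<close>, hence consecutive to \<open>u\<close>.\<close>
    obtain w where w: "w \<in> S - {u}" "\<And>x. x \<in> S - {u} \<Longrightarrow> x \<noteq> w \<Longrightarrow> (w, x) \<in> parcs T"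
    proof (rule block_source[OF T b, of "S - {u}" "b q"])
      show "S - {u} \<noteq> {}" using S(4,5) pq(3) by blast
      show "finite (S - {u})" "S - {u} \<subseteq> pverts T" using S(1,2) by auto
      show "b x = b q" if "x \<in> S - {u}" for x using S(3) that by simp
    qed blast
    define rest where "rest = filter (\<lambda>x. x \<noteq> u \<and> x \<noteq> w) vs"
    have uw: "u \<in> set vs" "w \<in> set vs" "u \<noteq> w" "b u = b q" "b w = b q"
      using u(1) w(1) by (auto simp: S_def)
    have rest: "distinct rest" "set rest = set vs - {u, w}"
      using less.prems by (auto simp: rest_def)
    have "det (skew_adj_mat T vs) = det (skew_adj_mat T (u # w # rest))"
      using less.prems rest uw by (intro det_skew_adj_mat_cong) auto
    also have "\<dots> = det (skew_adj_mat T rest)"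
    proof (rule det_skew_adj_mat_remove_twins)
      show arc: "(u, w) \<in> parcs T" using u w by auto
      show "(w, u) \<notin> parcs T" "(u, u) \<notin> parcs T" "(w, w) \<notin> parcs T"
        using arc TD(2,3) by blast+
      fix x assume "x \<in> set rest"
      then have x: "x \<in> set vs" "x \<noteq> u" "x \<noteq> w" using rest by auto
      have V: "x \<in> pverts T" "u \<in> pverts T" "w \<in> pverts T"
        using x uw less.prems by auto
      \<comment> \<open>Within the block both \<open>u\<close> and \<open>w\<close> beat
        \<open>x\<close>; outside it both arcs are decided by the same pair of vertices of
        \<open>R\<close>.\<close>
      show ux: "(u, x) \<in> parcs T \<longleftrightarrow> (w, x) \<in> parcs T"
      proof (cases "b x = b q")
        case True
        then have "x \<in> S" using x by (simp add: S_def)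
        with u w x show ?thesis by auto
      next
        case False
        with b V uw show ?thesis unfolding block_map_def by metis
      qed
      then show "(x, u) \<in> parcs T \<longleftrightarrow> (x, w) \<in> parcs T"
        using TD(3)[of u x] TD(3)[of w x] V x by auto
    qed
    finally have "det (skew_adj_mat T vs) = det (skew_adj_mat T rest)" .
    moreover have "length rest < length vs"
      unfolding rest_def using uw(1) by (intro length_filter_less) auto
    ultimately show ?thesis
      using less.hyps[of rest] rest less.prems by auto
  qed
qed

theorem theorem3p3:
  fixes k :: nat
    and R :: "'a pair_pre_digraph"
    and a :: "'a \<Rightarrow> nat"
    and T :: "'b pair_pre_digraph"
  assumes "0 < k" and "odd k"
    and "tournament R"
    and "\<forall>v \<in> pverts R. 0 < a v"
    and "transitive_blowup R a T"
  shows "R \<in> det_class k \<longleftrightarrow> T \<in> det_class k"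
proof -
  note R = assms(3)
  obtain b where T: "tournament T" and b: "block_map R T b"
    using transitive_blowup_block_map assms by blast
  have surj: "b ` pverts T = pverts R" using b by (simp add: block_map_def)
  show ?thesis
    unfolding mem_det_class_iff[OF R assms(1)] mem_det_class_iff[OF T assms(1)]
  proof (intro iffI allI impI; elim conjE)
    fix vs
    assume bound: "\<forall>vs. distinct vs \<and> set vs \<subseteq> pverts R \<longrightarrow> det (skew_adj_mat R vs) \<le> (int k)\<^sup>2"
      and vs: "distinct vs" "set vs \<subseteq> pverts T"
    \<comment> \<open>The reduced list meets each block at most once, so its image is a list of
      distinct vertices of \<open>R\<close>, possibly empty, to which the bound applies.\<close>
    obtain ws where ws: "distinct ws" "set ws \<subseteq> pverts T" "inj_on b (set ws)"
      "det (skew_adj_mat T vs) = det (skew_adj_mat T ws)"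
      using det_skew_adj_mat_reduce[OF T b vs] by blast
    have "distinct (map b ws)" "set (map b ws) \<subseteq> pverts R"
      using ws surj by (auto simp: distinct_map)
    with bound have "det (skew_adj_mat R (map b ws)) \<le> (int k)\<^sup>2" by blast
    then show "det (skew_adj_mat T vs) \<le> (int k)\<^sup>2"
      using ws det_skew_adj_mat_map[OF R T b] by simp
  next
    fix vs
    assume bound: "\<forall>vs. distinct vs \<and> set vs \<subseteq> pverts T \<longrightarrow> det (skew_adj_mat T vs) \<le> (int k)\<^sup>2"
      and vs: "distinct vs" "set vs \<subseteq> pverts R"
    \<comment> \<open>One representative is chosen in the block of each listed vertex;
      \<open>b\<close> maps the representatives back to \<open>vs\<close>, which gives their
      distinctness and the injectivity of \<open>b\<close> on them.\<close>
    let ?ws = "map (inv_into (pverts T) b) vs"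
    have inv: "map b ?ws = vs"
      using vs surj by (intro nth_equalityI) (auto simp: f_inv_into_f subset_iff)
    then have "distinct (map b ?ws)" using vs by simp
    then have ws: "distinct ?ws" "inj_on b (set ?ws)"
      by (simp_all only: distinct_map)
    have sub: "set ?ws \<subseteq> pverts T"
      using vs(2) by (auto simp: surj intro!: inv_into_into)
    have "det (skew_adj_mat T ?ws) \<le> (int k)\<^sup>2" using bound ws sub by blast
    then show "det (skew_adj_mat R vs) \<le> (int k)\<^sup>2"
      using det_skew_adj_mat_map[OF R T b sub ws(2)] inv by simp
  qed
qed

end
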